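(* An implicative-orthomodular lattice $X$ is distributive if and only if it satisfies the divisibility condition $x\to(x\to y)^*=x\to y^*$ for all $x,y\in X$.
   Context: A BE algebra is an algebra $(X,\to,1)$ of type $(2,0)$ such that for all $x,y,z\in X$: $x\to x=1$; $x\to 1=1$; $1\to x=x$; $x\to(y\to z)=y\to(x\to z)$. Write $x\le y$ iff $x\to y=1$. It is bounded if there is $0\in X$ with $0\le x$ for all $x\in X$; then $x^*:=x\to 0$. A bounded BE algebra is involutive if $x^{**}=x$ for all $x$. A BE algebra is implicative if $(x\to y)\to x=x$ for all $x,y$. In an involutive BE algebra put $x\Cap y:=((x^*\to y^* )\to y^* )^*$. An implicative-orthomodular lattice is an implicative involutive BE algebra satisfying $x\Cap(y\to x)=x$ for all $x,y$. An implicative-orthomodular lattice $X$ is distributive if for all $x,y,z\in X$ both of the following hold: $(Idis_1)$ $((x^*\to y)\to z^* )^*=(x\to z^* )\to(y\to z^* )^*$; $(Idis_2)$ $((x\to y^* )\to z)^*=(z^*\to x)\to(z^*\to y)^*$. *)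

theory Defs
  imports Main
begin

locale BE_algebra =
  fixes X :: "'a set"
    and imp :: "'a \<Rightarrow> 'a \<Rightarrow> 'a"  (infixr \<open>\<rightarrow>\<close> 60)
    and one :: 'a  (\<open>\<one>\<close>)
  assumes imp_closed: "x \<in> X \<Longrightarrow> y \<in> X \<Longrightarrow> x \<rightarrow> y \<in> X"
    and one_closed: "\<one> \<in> X"
    and imp_self: "x \<in> X \<Longrightarrow> x \<rightarrow> x = \<one>"
    and imp_one: "x \<in> X \<Longrightarrow> x \<rightarrow> \<one> = \<one>"
    and one_imp: "x \<in> X \<Longrightarrow> \<one> \<rightarrow> x = x"
    and exchange: "x \<in> X \<Longrightarrow> y \<in> X \<Longrightarrow> z \<in> X \<Longrightarrow> x \<rightarrow> (y \<rightarrow> z) = y \<rightarrow> (x \<rightarrow> z)"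
begin

definition le :: "'a \<Rightarrow> 'a \<Rightarrow> bool"  (infix \<open>\<preceq>\<close> 50)
  where "x \<preceq> y \<longleftrightarrow> x \<rightarrow> y = \<one>"

end

text \<open>The relation \<open>\<preceq>\<close> need not be antisymmetric in a BE algebra, so a least element need not be
  unique. The element used to define the complement is therefore a parameter of the locale.
  In the involutive case it is unique.\<close>

locale bounded_BE_algebra = BE_algebra +
  fixes zero :: 'a  (\<open>\<zero>\<close>)
  assumes zero_closed: "\<zero> \<in> X"
    and zero_le: "x \<in> X \<Longrightarrow> \<zero> \<preceq> x"
begin

definition star :: "'a \<Rightarrow> 'a"  (\<open>_\<^sup>\<star>\<close> [1000] 1000)
  where "x\<^sup>\<star> = x \<rightarrow> \<zero>"

end

locale involutive_BE_algebra = bounded_BE_algebra +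
  assumes involutive: "x \<in> X \<Longrightarrow> x\<^sup>\<star>\<^sup>\<star> = x"
begin

definition cap :: "'a \<Rightarrow> 'a \<Rightarrow> 'a"  (infixl \<open>\<Cap>\<close> 70)
  where "x \<Cap> y = ((x\<^sup>\<star> \<rightarrow> y\<^sup>\<star>) \<rightarrow> y\<^sup>\<star>)\<^sup>\<star>"

end

locale implicative_BE_algebra = BE_algebra +
  assumes implicative: "x \<in> X \<Longrightarrow> y \<in> X \<Longrightarrow> (x \<rightarrow> y) \<rightarrow> x = x"

locale implicative_orthomodular_lattice =
  involutive_BE_algebra + implicative_BE_algebra +
  assumes orthomodular: "x \<in> X \<Longrightarrow> y \<in> X \<Longrightarrow> x \<Cap> (y \<rightarrow> x) = x"
begin

definition distributive :: bool
  where "distributive \<longleftrightarrow>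
    (\<forall>x\<in>X. \<forall>y\<in>X. \<forall>z\<in>X.
      ((x\<^sup>\<star> \<rightarrow> y) \<rightarrow> z\<^sup>\<star>)\<^sup>\<star> = (x \<rightarrow> z\<^sup>\<star>) \<rightarrow> (y \<rightarrow> z\<^sup>\<star>)\<^sup>\<star> \<and>
      ((x \<rightarrow> y\<^sup>\<star>) \<rightarrow> z)\<^sup>\<star> = (z\<^sup>\<star> \<rightarrow> x) \<rightarrow> (z\<^sup>\<star> \<rightarrow> y)\<^sup>\<star>)"

definition divisible :: bool
  where "divisible \<longleftrightarrow> (\<forall>x\<in>X. \<forall>y\<in>X. x \<rightarrow> (x \<rightarrow> y)\<^sup>\<star> = x \<rightarrow> y\<^sup>\<star>)"

end

end

theory Submission
  imports Defs
begin

text \<open>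
  With the join \<open>x\<^sup>\<star> \<rightarrow> y\<close> and the meet \<open>(x \<rightarrow> y\<^sup>\<star>)\<^sup>\<star>\<close>, an implicative involutive BE algebra
  is an ortholattice. Then \<open>Idis\<^sub>1\<close> and \<open>Idis\<^sub>2\<close> are the two distributive laws, and divisibility
  says that the meet of \<open>x\<close> with the join of \<open>x\<^sup>\<star>\<close> and \<open>y\<close> is the meet of \<open>x\<close> and \<open>y\<close>.
  This is an instance of distributivity. Conversely, let \<open>b\<close> be the meet of \<open>z\<close> with the join of
  \<open>x\<close> and \<open>y\<close>, and let \<open>a\<close> be its expansion, which lies below \<open>b\<close>. By divisibility the meet of
  \<open>b\<close> and \<open>a\<^sup>\<star>\<close> is \<open>\<zero>\<close>, and by divisibility again \<open>b\<close> lies below \<open>a\<close>.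
\<close>

context involutive_BE_algebra
begin

definition join :: "'a \<Rightarrow> 'a \<Rightarrow> 'a"  (infixl \<open>\<squnion>\<close> 65)
  where "x \<squnion> y = x\<^sup>\<star> \<rightarrow> y"

definition meet :: "'a \<Rightarrow> 'a \<Rightarrow> 'a"  (infixl \<open>\<sqinter>\<close> 70)
  where "x \<sqinter> y = (x \<rightarrow> y\<^sup>\<star>)\<^sup>\<star>"

lemma star_closed [simp]: "x \<in> X \<Longrightarrow> x\<^sup>\<star> \<in> X"
  by (simp add: star_def imp_closed zero_closed)

lemma join_closed [simp]: "x \<in> X \<Longrightarrow> y \<in> X \<Longrightarrow> x \<squnion> y \<in> X"
  by (simp add: join_def imp_closed)

lemma meet_closed [simp]: "x \<in> X \<Longrightarrow> y \<in> X \<Longrightarrow> x \<sqinter> y \<in> X"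
  by (simp add: meet_def imp_closed)

lemma star_zero: "\<zero>\<^sup>\<star> = \<one>"
  by (simp add: star_def imp_self zero_closed)

lemma star_one: "\<one>\<^sup>\<star> = \<zero>"
  by (simp add: star_def one_imp zero_closed)

text \<open>Both sides unfold to implications ending in \<open>\<zero>\<close>, so this is
  \<open>exchange\<close> with third argument \<open>\<zero>\<close>. It yields commutativity of the
  join.\<close>

lemma contraposition:
  assumes "x \<in> X" "y \<in> X"
  shows "x \<rightarrow> y\<^sup>\<star> = y \<rightarrow> x\<^sup>\<star>"
  using assms by (simp add: star_def exchange zero_closed)

lemma join_commute: "x \<in> X \<Longrightarrow> y \<in> X \<Longrightarrow> x \<squnion> y = y \<squnion> x"
  using contraposition [of "x\<^sup>\<star>" "y\<^sup>\<star>"] by (simp add: join_def involutive)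

lemma join_left_commute:
  "x \<in> X \<Longrightarrow> y \<in> X \<Longrightarrow> z \<in> X \<Longrightarrow> x \<squnion> (y \<squnion> z) = y \<squnion> (x \<squnion> z)"
  by (simp add: join_def exchange)

lemma join_assoc:
  assumes "x \<in> X" "y \<in> X" "z \<in> X"
  shows "x \<squnion> y \<squnion> z = x \<squnion> (y \<squnion> z)"
  using assms by (metis join_closed join_commute join_left_commute)

lemma star_join: "x \<in> X \<Longrightarrow> y \<in> X \<Longrightarrow> (x \<squnion> y)\<^sup>\<star> = x\<^sup>\<star> \<sqinter> y\<^sup>\<star>"
  by (simp add: join_def meet_def involutive)

lemma star_meet: "x \<in> X \<Longrightarrow> y \<in> X \<Longrightarrow> (x \<sqinter> y)\<^sup>\<star> = x\<^sup>\<star> \<squnion> y\<^sup>\<star>"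
  by (simp add: join_def meet_def involutive imp_closed)

lemma meet_eq_star_join: "x \<in> X \<Longrightarrow> y \<in> X \<Longrightarrow> x \<sqinter> y = (x\<^sup>\<star> \<squnion> y\<^sup>\<star>)\<^sup>\<star>"
  by (simp add: star_join involutive)

lemma meet_commute: "x \<in> X \<Longrightarrow> y \<in> X \<Longrightarrow> x \<sqinter> y = y \<sqinter> x"
  by (simp add: meet_eq_star_join join_commute)

lemma meet_left_commute:
  assumes "x \<in> X" "y \<in> X" "z \<in> X"
  shows "x \<sqinter> (y \<sqinter> z) = y \<sqinter> (x \<sqinter> z)"
  using assms join_left_commute [of "x\<^sup>\<star>" "y\<^sup>\<star>" "z\<^sup>\<star>"]
  by (simp add: meet_eq_star_join involutive)

lemma meet_assoc:
  assumes "x \<in> X" "y \<in> X" "z \<in> X"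
  shows "x \<sqinter> y \<sqinter> z = x \<sqinter> (y \<sqinter> z)"
  using assms by (metis meet_closed meet_commute meet_left_commute)

lemma zero_join: "x \<in> X \<Longrightarrow> \<zero> \<squnion> x = x"
  by (simp add: join_def star_zero one_imp)

lemma one_meet: "x \<in> X \<Longrightarrow> \<one> \<sqinter> x = x"
  by (simp add: meet_def one_imp involutive)

lemma zero_meet: "x \<in> X \<Longrightarrow> \<zero> \<sqinter> x = \<zero>"
  using zero_le [of "x\<^sup>\<star>"] by (simp add: meet_def le_def star_one)

lemma meet_star: "x \<in> X \<Longrightarrow> x \<sqinter> x\<^sup>\<star> = \<zero>"
  by (simp add: meet_def involutive imp_self star_one)

end

context implicative_orthomodular_lattice
begin

text \<open>This is the implicative law at \<open>x\<close> and \<open>y\<^sup>\<star>\<close>, read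
  through the involution.\<close>

lemma join_meet_absorb:
  assumes "x \<in> X" "y \<in> X"
  shows "x \<squnion> x \<sqinter> y = x"
proof -
  have "x \<sqinter> y \<squnion> x = x"
    using assms implicative [of x "y\<^sup>\<star>"] by (simp add: join_def meet_def involutive imp_closed)
  then show ?thesis
    using assms by (simp add: join_commute)
qed

lemma meet_join_absorb:
  assumes "x \<in> X" "y \<in> X"
  shows "x \<sqinter> (x \<squnion> y) = x"
  using assms join_meet_absorb [of "x\<^sup>\<star>" "y\<^sup>\<star>"]
  by (simp add: meet_eq_star_join involutive)

lemma meet_idem:
  assumes "x \<in> X"
  shows "x \<sqinter> x = x"
  \<comment> \<open>The second \<open>x\<close> expands to
    \<open>x \<squnion> x \<sqinter> x\<close>, and the other absorption law then applies.\<close>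
  using assms by (metis join_meet_absorb meet_join_absorb meet_closed)

text \<open>Monotonicity of the meet, with the order expressed by \<open>u \<squnion> v = v\<close>.
  The meet of the two sides is the smaller one, and absorption turns this into a statement on
  joins.\<close>

lemma meet_le_meet_join:
  assumes "x \<in> X" "y \<in> X" "z \<in> X"
  shows "x \<sqinter> z \<squnion> (x \<squnion> y) \<sqinter> z = (x \<squnion> y) \<sqinter> z"
proof -
  have "(x \<squnion> y) \<sqinter> z \<sqinter> (x \<sqinter> z) = x \<sqinter> (x \<squnion> y) \<sqinter> (z \<sqinter> z)"
    using assms by (simp add: meet_assoc meet_commute meet_left_commute)
  also have "\<dots> = x \<sqinter> z"
    using assms by (simp add: meet_join_absorb meet_idem)
  finally show ?thesis
    using assms by (metis join_meet_absorb join_commute join_closed meet_closed)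
qed

text \<open>The first condition is this law verbatim. The second is the same law at
  \<open>x\<^sup>\<star>\<close>, \<open>y\<^sup>\<star>\<close>, \<open>z\<^sup>\<star>\<close>, up
  to commuting meets.\<close>

lemma distributive_iff:
  "distributive \<longleftrightarrow> (\<forall>x\<in>X. \<forall>y\<in>X. \<forall>z\<in>X. (x \<squnion> y) \<sqinter> z = x \<sqinter> z \<squnion> y \<sqinter> z)"
  (is "_ \<longleftrightarrow> ?D")
proof
  show ?D if distributive
    using that by (simp add: distributive_def join_def meet_def involutive imp_closed)
  assume D: ?D
  have "((x \<rightarrow> y\<^sup>\<star>) \<rightarrow> z)\<^sup>\<star> = (z\<^sup>\<star> \<rightarrow> x) \<rightarrow> (z\<^sup>\<star> \<rightarrow> y)\<^sup>\<star>"
    if "x \<in> X" "y \<in> X" "z \<in> X" for x y z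
  proof -
    have "(x\<^sup>\<star> \<squnion> y\<^sup>\<star>) \<sqinter> z\<^sup>\<star> = x\<^sup>\<star> \<sqinter> z\<^sup>\<star> \<squnion> y\<^sup>\<star> \<sqinter> z\<^sup>\<star>"
      using D that by simp
    also have "\<dots> = z\<^sup>\<star> \<sqinter> x\<^sup>\<star> \<squnion> z\<^sup>\<star> \<sqinter> y\<^sup>\<star>"
      using that by (simp add: meet_commute)
    finally show ?thesis
      using that by (simp add: join_def meet_def involutive imp_closed)
  qed
  with D show distributive
    by (simp add: distributive_def join_def meet_def involutive imp_closed)
qed

text \<open>The two equations are complements of each other, and the involution makes complementing
  reversible.\<close>

lemma divisible_iff:
  "divisible \<longleftrightarrow> (\<forall>x\<in>X. \<forall>y\<in>X. x \<sqinter> (x\<^sup>\<star> \<squnion> y) = x \<sqinter> y)"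
proof -
  have "x \<sqinter> (x\<^sup>\<star> \<squnion> y) = x \<sqinter> y \<longleftrightarrow> x \<rightarrow> (x \<rightarrow> y)\<^sup>\<star> = x \<rightarrow> y\<^sup>\<star>"
    if "x \<in> X" "y \<in> X" for x y
    using that by (metis join_def meet_def involutive imp_closed star_closed)
  then show ?thesis
    by (simp add: divisible_def)
qed

lemma distributive_imp_divisible:
  assumes distributive
  shows divisible
  unfolding divisible_iff
proof (intro ballI)
  fix x y assume xy: "x \<in> X" "y \<in> X"
  \<comment> \<open>The first summand on the right is \<open>\<zero>\<close>, so only
    \<open>y \<sqinter> x\<close> survives.\<close>
  have "(x\<^sup>\<star> \<squnion> y) \<sqinter> x = x\<^sup>\<star> \<sqinter> x \<squnion> y \<sqinter> x"
    using assms xy by (simp add: distributive_iff)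
  then show "x \<sqinter> (x\<^sup>\<star> \<squnion> y) = x \<sqinter> y"
    using xy by (simp add: meet_commute [of _ x] meet_star zero_join)
qed

lemma divisible_imp_distributive:
  assumes divisible
  shows distributive
  unfolding distributive_iff
proof (intro ballI)
  fix x y z assume xyz [simp]: "x \<in> X" "y \<in> X" "z \<in> X"
  have div: "u \<sqinter> (u\<^sup>\<star> \<squnion> v) = u \<sqinter> v" if "u \<in> X" "v \<in> X" for u v
    using assms that by (simp add: divisible_iff)
  define a where "a = x \<sqinter> z \<squnion> y \<sqinter> z"
  define b where "b = (x \<squnion> y) \<sqinter> z"
  have [simp]: "a \<in> X" "b \<in> X"
    by (simp_all add: a_def b_def)
  have "x \<sqinter> z \<squnion> b = b" "y \<sqinter> z \<squnion> b = b"
    using meet_le_meet_join [of x y z] meet_le_meet_join [of y x z]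
    by (simp_all add: b_def join_commute)
  then have "a \<squnion> b = b"
    by (simp add: a_def join_assoc)
  \<comment> \<open>De Morgan turns \<open>a\<^sup>\<star>\<close> into a meet of two joins
    containing \<open>z\<^sup>\<star>\<close>. Next to the factor \<open>z\<close> of
    \<open>b\<close>, divisibility strips \<open>z\<^sup>\<star>\<close> from each in turn, leaving
    the complement of \<open>x \<squnion> y\<close>.\<close>
  have "b \<sqinter> a\<^sup>\<star> = (x \<squnion> y) \<sqinter> (z \<sqinter> (z\<^sup>\<star> \<squnion> x\<^sup>\<star>) \<sqinter> (z\<^sup>\<star> \<squnion> y\<^sup>\<star>))"
    by (simp add: a_def b_def star_join star_meet meet_assoc join_commute)
  also have "z \<sqinter> (z\<^sup>\<star> \<squnion> x\<^sup>\<star>) = x\<^sup>\<star> \<sqinter> z"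
    by (simp add: div meet_commute)
  also have "\<dots> \<sqinter> (z\<^sup>\<star> \<squnion> y\<^sup>\<star>) = x\<^sup>\<star> \<sqinter> (z \<sqinter> (z\<^sup>\<star> \<squnion> y\<^sup>\<star>))"
    by (simp add: meet_assoc)
  also have "z \<sqinter> (z\<^sup>\<star> \<squnion> y\<^sup>\<star>) = y\<^sup>\<star> \<sqinter> z"
    by (simp add: div meet_commute)
  also have "x\<^sup>\<star> \<sqinter> \<dots> = (x \<squnion> y)\<^sup>\<star> \<sqinter> z"
    by (simp add: star_join meet_assoc)
  also have "(x \<squnion> y) \<sqinter> \<dots> = (x \<squnion> y) \<sqinter> (x \<squnion> y)\<^sup>\<star> \<sqinter> z"
    by (simp add: meet_assoc)
  also have "\<dots> = \<zero>"
    by (simp add: meet_star zero_meet)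
  finally have "(b \<sqinter> a\<^sup>\<star>)\<^sup>\<star> = \<one>"
    by (simp add: star_zero)
  then have "b\<^sup>\<star> \<squnion> a = \<one>"
    by (simp add: star_meet involutive)
  \<comment> \<open>The join in \<open>div\<close> is now \<open>\<one>\<close>, so its left side
    reduces to \<open>b\<close>.\<close>
  then have "b \<sqinter> a = b"
    using div [of b a] by (simp add: meet_commute [of b \<one>] one_closed one_meet)
  \<comment> \<open>The same join was shown equal to \<open>b\<close>, so the two values give
    \<open>a = b\<close>.\<close>
  then have "a \<squnion> b = a"
    using join_meet_absorb [of a b] by (simp add: meet_commute)
  with \<open>a \<squnion> b = b\<close> show "(x \<squnion> y) \<sqinter> z = x \<sqinter> z \<squnion> y \<sqinter> z"
    by (simp add: a_def b_def)
qed

end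

theorem theorem4p19:
  fixes X :: "'a set" and imp :: "'a \<Rightarrow> 'a \<Rightarrow> 'a" and one zero :: 'a
  assumes "implicative_orthomodular_lattice X imp one zero"
  shows "implicative_orthomodular_lattice.distributive X imp zero
    \<longleftrightarrow> implicative_orthomodular_lattice.divisible X imp zero"
proof -
  interpret implicative_orthomodular_lattice X imp one zero
    by (fact assms)
  show ?thesis
    using distributive_imp_divisible divisible_imp_distributive by blast
qed

end
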